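(* Let $D\ge 1$ and let $N\ge n$. There is a deterministic algorithm (Algorithm 1 of the paper), in which processes know $D$ and $N$, that solves consensus among the $n$ processes under the message adversary $\lozenge\mathrm{STABLE}_D(D+1)$.
   Context: Model: a finite set $\Pi$ of $n$ processes with unique identifiers, which never fail and run in lock-step synchronous rounds $r=1,2,\dots$; in each round every process sends a message to every other process, receives some of them, and makes a local state transition. The round-$r$ communication graph $\mathcal{G}^r$ is a directed graph on $\Pi$ with edge $(p\to q)$ iff $q$ receives $p$'s round-$r$ message; all self-loops are always present. A message adversary is a set of infinite sequences of communication graphs (the admissible sequences); an algorithm solves consensus under a message adversary if for every assignment of inputs and every admissible sequence the run satisfies: Termination (every process eventually irrevocably decides), Agreement (all decisions are equal), Validity (every decision is some process's input). A root component of a graph $\mathcal{G}$ is a nonempty $R\subseteq\Pi$ that is the vertex set of a strongly connected component of $\mathcal{G}$ with no edge $(p\to q)$, $q\in R$, $p\notin R$. A graph is rooted if it has exactly one root component $\operatorname{Root}(\mathcal{G})$. A nonempty sequence of consecutive graphs is $R$-rooted if each graph in it is rooted with root component $R$. Compound graph: $(p,q)\in\mathcal{G}\circ\mathcal{G}'$ iff $(p,p')\in\mathcal{G}$ and $(p',q)\in\mathcal{G}'$ for some $p'$. Causal past: $\mathrm{CP}_p(a,a)=\{p\}$ and, for $a<b$, $\mathrm{CP}_p(a,b)$ is the set of in-neighbours of $p$ in $\mathcal{G}^{a+1}\circ\cdots\circ\mathcal{G}^b$. $\mathrm{DIAM}(D)$: all sequences such that for every subsequence $\mathcal{G}^{r_1},\dots,\mathcal{G}^{r_1+D-1}$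 of $D$ consecutive graphs that is $R$-rooted, $R\subseteq \mathrm{CP}_p(r_1-1,r_1+D-1)$ for every $p\in\Pi$. $\lozenge\mathrm{STABILITY}(x)$: all sequences containing, for some $R\subseteq\Pi$, an $R$-rooted subsequence of at least $x$ consecutive graphs. $\mathrm{ROOTED}$: all sequences in which every graph is rooted. $\lozenge\mathrm{STABLE}_D(x)=\mathrm{ROOTED}\cap\lozenge\mathrm{STABILITY}(x)\cap\mathrm{DIAM}(D)$. *)

theory Defs
  imports Main
begin

section \<open>Communication graphs\<close>

text \<open>A communication graph on the process set Pi is a relation on Pi (edge (p,q) means
  q receives p's message) containing all self-loops.\<close>
definition is_graph :: "'p set \<Rightarrow> ('p \<times> 'p) set \<Rightarrow> bool" where
  "is_graph Pi G \<longleftrightarrow> G \<subseteq> Pi \<times> Pi \<and> (\<forall>p\<in>Pi. (p, p) \<in> G)"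

text \<open>R is a root component: the vertex set of a strongly connected component of G
  without incoming edges from outside.\<close>
definition root_component :: "'p set \<Rightarrow> ('p \<times> 'p) set \<Rightarrow> 'p set \<Rightarrow> bool" where
  "root_component Pi G R \<longleftrightarrow>
     R \<noteq> {} \<and> R \<subseteq> Pi \<and>
     (\<forall>p\<in>R. \<forall>q\<in>R. (p, q) \<in> G\<^sup>*) \<and>
     (\<forall>p\<in>Pi. (\<exists>q\<in>R. (p, q) \<in> G\<^sup>* \<and> (q, p) \<in> G\<^sup>*) \<longrightarrow> p \<in> R) \<and>
     (\<forall>p q. (p, q) \<in> G \<and> q \<in> R \<longrightarrow> p \<in> R)"

definition rooted :: "'p set \<Rightarrow> ('p \<times> 'p) set \<Rightarrow> bool" where
  "rooted Pi G \<longleftrightarrow> (\<exists>!R. root_component Pi G R)"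

definition Root :: "'p set \<Rightarrow> ('p \<times> 'p) set \<Rightarrow> 'p set" where
  "Root Pi G = (THE R. root_component Pi G R)"

text \<open>Graph sequences: Gs r is the round-r graph (rounds r = 1, 2, ...; Gs 0 is unused).
  The rounds a, ..., b (a \<le> b) form an R-rooted subsequence.\<close>
definition R_rooted_seq :: "'p set \<Rightarrow> (nat \<Rightarrow> ('p \<times> 'p) set) \<Rightarrow> 'p set \<Rightarrow> nat \<Rightarrow> nat \<Rightarrow> bool" where
  "R_rooted_seq Pi Gs R a b \<longleftrightarrow> (\<forall>r\<in>{a..b}. rooted Pi (Gs r) \<and> Root Pi (Gs r) = R)"

text \<open>Compound graph Gs (a+1) o ... o Gs b (identity if b \<le> a).\<close>
fun compound :: "(nat \<Rightarrow> ('p \<times> 'p) set) \<Rightarrow> nat \<Rightarrow> nat \<Rightarrow> ('p \<times> 'p) set" where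
  "compound Gs a 0 = Id"
| "compound Gs a (Suc b) = (if Suc b \<le> a then Id else compound Gs a b O Gs (Suc b))"

text \<open>Causal past CP_p(a,b): {p} if a = b, in-neighbours of p in the compound graph otherwise.\<close>
definition CP :: "(nat \<Rightarrow> ('p \<times> 'p) set) \<Rightarrow> 'p \<Rightarrow> nat \<Rightarrow> nat \<Rightarrow> 'p set" where
  "CP Gs p a b = {q. (q, p) \<in> compound Gs a b}"

section \<open>Message adversaries\<close>

definition DIAM :: "'p set \<Rightarrow> nat \<Rightarrow> (nat \<Rightarrow> ('p \<times> 'p) set) set" where
  "DIAM Pi D = {Gs. \<forall>r1 \<ge> 1. \<forall>R. R_rooted_seq Pi Gs R r1 (r1 + D - 1) \<longrightarrow>
                       (\<forall>p\<in>Pi. R \<subseteq> CP Gs p (r1 - 1) (r1 + D - 1))}"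

definition EV_STABILITY :: "'p set \<Rightarrow> nat \<Rightarrow> (nat \<Rightarrow> ('p \<times> 'p) set) set" where
  "EV_STABILITY Pi x = {Gs. \<exists>R. \<exists>r1 \<ge> 1. \<exists>len \<ge> x. len \<ge> 1 \<and> R_rooted_seq Pi Gs R r1 (r1 + len - 1)}"

definition ROOTED :: "'p set \<Rightarrow> (nat \<Rightarrow> ('p \<times> 'p) set) set" where
  "ROOTED Pi = {Gs. \<forall>r \<ge> 1. rooted Pi (Gs r)}"

text \<open>All graph sequences on Pi (every round graph is a communication graph on Pi).\<close>
definition GRAPH_SEQS :: "'p set \<Rightarrow> (nat \<Rightarrow> ('p \<times> 'p) set) set" where
  "GRAPH_SEQS Pi = {Gs. \<forall>r \<ge> 1. is_graph Pi (Gs r)}"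

definition EV_STABLE :: "'p set \<Rightarrow> nat \<Rightarrow> nat \<Rightarrow> (nat \<Rightarrow> ('p \<times> 'p) set) set" where
  "EV_STABLE Pi D x = GRAPH_SEQS Pi \<inter> ROOTED Pi \<inter> EV_STABILITY Pi x \<inter> DIAM Pi D"

section \<open>Algorithms and runs\<close>

text \<open>A universal type of finite data (states and messages) over identifiers and values.\<close>
datatype ('p, 'v) obj = Val 'v | Pid 'p | Num nat | Lst "('p, 'v) obj list"

text \<open>A deterministic algorithm: initial state from own id and input, the message broadcast
  in a round as a function of the current state, the state transition from the received
  messages (partial map sender \<mapsto> message), and the decision output (None = undecided).\<close>
record ('p, 'v) algorithm =
  alg_init :: "'p \<Rightarrow> 'v \<Rightarrow> ('p, 'v) obj"
  alg_send :: "'p \<Rightarrow> ('p, 'v) obj \<Rightarrow> ('p, 'v) obj"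
  alg_step :: "'p \<Rightarrow> ('p, 'v) obj \<Rightarrow> ('p \<Rightarrow> ('p, 'v) obj option) \<Rightarrow> ('p, 'v) obj"
  alg_dec :: "'p \<Rightarrow> ('p, 'v) obj \<Rightarrow> 'v option"

text \<open>State of each process at the end of round r (r = 0: initial state).\<close>
primrec run :: "('p, 'v) algorithm \<Rightarrow> 'p set \<Rightarrow> (nat \<Rightarrow> ('p \<times> 'p) set) \<Rightarrow> ('p \<Rightarrow> 'v)
                 \<Rightarrow> nat \<Rightarrow> 'p \<Rightarrow> ('p, 'v) obj" where
  "run A Pi Gs x 0 p = alg_init A p (x p)"
| "run A Pi Gs x (Suc r) p =
     alg_step A p (run A Pi Gs x r p)
       (\<lambda>q. if q \<in> Pi \<and> (q, p) \<in> Gs (Suc r) then Some (alg_send A q (run A Pi Gs x r q)) else None)"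

definition decision :: "('p, 'v) algorithm \<Rightarrow> 'p set \<Rightarrow> (nat \<Rightarrow> ('p \<times> 'p) set) \<Rightarrow> ('p \<Rightarrow> 'v)
                 \<Rightarrow> nat \<Rightarrow> 'p \<Rightarrow> 'v option" where
  "decision A Pi Gs x r p = alg_dec A p (run A Pi Gs x r p)"

definition solves_consensus ::
  "('p, 'v) algorithm \<Rightarrow> 'p set \<Rightarrow> (nat \<Rightarrow> ('p \<times> 'p) set) set \<Rightarrow> bool" where
  "solves_consensus A Pi MA \<longleftrightarrow>
    (\<forall>x :: 'p \<Rightarrow> 'v. \<forall>Gs \<in> MA.
      \<comment> \<open>Termination\<close>
      (\<forall>p\<in>Pi. \<exists>r v. decision A Pi Gs x r p = Some v) \<and>
      \<comment> \<open>Irrevocability of decisions\<close>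
      (\<forall>p\<in>Pi. \<forall>r r' v. r \<le> r' \<and> decision A Pi Gs x r p = Some v
                          \<longrightarrow> decision A Pi Gs x r' p = Some v) \<and>
      \<comment> \<open>Agreement\<close>
      (\<forall>p\<in>Pi. \<forall>q\<in>Pi. \<forall>r r' v w. decision A Pi Gs x r p = Some v \<and> decision A Pi Gs x r' q = Some w
                          \<longrightarrow> v = w) \<and>
      \<comment> \<open>Validity\<close>
      (\<forall>p\<in>Pi. \<forall>r v. decision A Pi Gs x r p = Some v \<longrightarrow> (\<exists>q\<in>Pi. v = x q)))"

end

theory Submission
  imports Defs
begin

text \<open>Processes exchange everything they know. A process \<open>p\<close> detects at time \<open>t\<close> the root of round \<open>r\<close>
  if all root members are in its causal past \<open>CP p r t\<close>. The value of round \<open>r\<close> is the estimate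
  that a fixed member of its root held just before the maximal block of rounds with this same root
  that ends in \<open>r\<close>; the estimate of a process is the value of the latest round whose root it has
  detected. A causal past grows strictly when traced back through an undetected round, so each
  process fails to detect fewer than \<open>n\<close> roots altogether. Hence, if the value is \<open>v\<close> throughout
  \<open>N\<close> consecutive rounds, all estimates equal \<open>v\<close> at their end, and then all later round values
  are \<open>v\<close>; so it is safe to decide \<open>v\<close> on detecting \<open>N\<close> such rounds. A block of \<open>D + 1\<close> rounds
  with the same root has the same effect, because by DIAM every process detects its first root by
  its end; from then on round values never change, and every process eventually detects \<open>N\<close> roots
  in a row.\<close>

section \<open>Root components\<close>

lemma root_component_iff:
  assumes "is_graph Pi G"
  shows "root_component Pi G R \<longleftrightarrow>
    R \<noteq> {} \<and> R \<subseteq> Pi \<and> (\<forall>p\<in>R. \<forall>q\<in>R. (p, q) \<in> G\<^sup>*) \<and> (\<forall>p q. (p, q) \<in> G \<and> q \<in> R \<longrightarrow> p \<in> R)"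
proof -
  have "p \<in> R" if "\<forall>p q. (p, q) \<in> G \<and> q \<in> R \<longrightarrow> p \<in> R" "(p, q) \<in> G\<^sup>*" "q \<in> R" for p q
    using that(2,3,1) by (induction rule: converse_rtrancl_induct) auto
  then show ?thesis unfolding root_component_def by meson
qed

text \<open>Tracing a path backwards from its end in \<open>R\<close> never leaves \<open>R\<close>,
  so the edges ending in \<open>R\<close> carry all paths between its members. These are the edges a
  process knows once it has detected \<open>R\<close>.\<close>

lemma rtrancl_closed_restrict:
  assumes "(p, q) \<in> G\<^sup>*" "q \<in> R" "\<And>p q. (p, q) \<in> G \<Longrightarrow> q \<in> R \<Longrightarrow> p \<in> R"
  shows "p \<in> R \<and> (p, q) \<in> (G \<inter> UNIV \<times> R)\<^sup>*"
  using assms(1,2)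
proof (induction rule: converse_rtrancl_induct)
  case base
  then show ?case by simp
next
  case (step y z)
  then have z: "z \<in> R" "(z, q) \<in> (G \<inter> UNIV \<times> R)\<^sup>*" by auto
  with step(1) have "(y, z) \<in> G \<inter> UNIV \<times> R" by simp
  then show ?case using z assms(3)[OF step(1)] by (meson converse_rtrancl_into_rtrancl)
qed

text \<open>A vertex of \<open>C\<close> with fewest ancestors works: the ancestors of any ancestor
  are among its own and no fewer, so both sets coincide and the two vertices reach each
  other.\<close>

lemma closed_contains_root_component:
  assumes "finite C" "C \<noteq> {}" "C \<subseteq> Pi" "is_graph Pi G"
    and closed: "\<And>p q. (p, q) \<in> G \<Longrightarrow> q \<in> C \<Longrightarrow> p \<in> C"
  shows "\<exists>R\<subseteq>C. root_component Pi G R"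
proof -
  define anc where "anc q = {p. (p, q) \<in> G\<^sup>*}" for q
  have sub: "anc q \<subseteq> C" if "q \<in> C" for q
    using rtrancl_closed_restrict[OF _ that closed] by (auto simp: anc_def)
  obtain q where q: "q \<in> C" and min: "\<And>p. p \<in> C \<Longrightarrow> card (anc q) \<le> card (anc p)"
    using assms(2) ex_has_least_nat[of "\<lambda>q. q \<in> C" _ "\<lambda>q. card (anc q)"] by blast
  have scc: "q \<in> anc p" if "p \<in> anc q" for p
  proof -
    have "anc p \<subseteq> anc q" using that by (auto simp: anc_def)
    moreover have "card (anc q) \<le> card (anc p)" using min sub[OF q] that by blast
    ultimately have "anc p = anc q"
      by (meson card_seteq finite_subset sub[OF q] assms(1))
    then show ?thesis by (simp add: anc_def)
  qed
  have "root_component Pi G (anc q)"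
    unfolding root_component_iff[OF assms(4)]
  proof (intro conjI ballI allI impI)
    show "anc q \<noteq> {}" by (auto simp: anc_def)
    show "anc q \<subseteq> Pi" using sub[OF q] assms(3) by blast
    show "(a, b) \<in> G\<^sup>*" if "a \<in> anc q" "b \<in> anc q" for a b
      using that scc[OF that(2)] by (auto simp: anc_def)
    show "a \<in> anc q" if "(a, b) \<in> G \<and> b \<in> anc q" for a b
      using that by (auto simp: anc_def intro: converse_rtrancl_into_rtrancl)
  qed
  with sub[OF q] show ?thesis by blast
qed

lemma root_component_Root: "rooted Pi G \<Longrightarrow> root_component Pi G (Root Pi G)"
  unfolding rooted_def Root_def by (rule theI')

lemma Root_unique: "rooted Pi G \<Longrightarrow> root_component Pi G R \<Longrightarrow> R = Root Pi G"
  using root_component_Root unfolding rooted_def by blast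

section \<open>Causal pasts\<close>

lemma compound_refl: "compound Gs a a = Id"
  by (cases a) auto

lemma CP_refl [simp]: "CP Gs p a a = {p}"
  by (simp add: CP_def compound_refl)

lemma CP_Suc: "a \<le> b \<Longrightarrow> CP Gs p a (Suc b) = (\<Union>q\<in>{q. (q, p) \<in> Gs (Suc b)}. CP Gs q a b)"
  by (auto simp: CP_def)

text \<open>\<open>CP_Suc\<close> unfolds the last round; this unfolds the first one, the direction
  in which causal pasts are shown to grow.\<close>

lemma CP_first_round:
  "a < b \<Longrightarrow> CP Gs p a b = {q. \<exists>q'\<in>CP Gs p (Suc a) b. (q, q') \<in> Gs (Suc a)}"
proof (induction b arbitrary: p)
  case (Suc b)
  show ?case
  proof (cases "a = b")
    case False
    then have "CP Gs q a b = {p. \<exists>q'\<in>CP Gs q (Suc a) b. (p, q') \<in> Gs (Suc a)}" for q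
      using Suc by simp
    with False Suc(2) show ?thesis by (auto simp: CP_Suc)
  qed (auto simp: CP_Suc)
qed simp

section \<open>The algorithm\<close>

text \<open>Local knowledge: \<open>E\<close> holds triples (round, sender, receiver) and \<open>X\<close> triples
  (time, process, estimate). Because of the self-loops, the triple \<open>(r, q, q)\<close> is in \<open>E\<close> exactly
  if all in-edges of \<open>q\<close> in round \<open>r\<close> are.\<close>

definition view_root :: "(nat \<times> 'p \<times> 'p) set \<Rightarrow> nat \<Rightarrow> 'p set \<Rightarrow> bool" where
  "view_root E r R \<longleftrightarrow> R \<noteq> {} \<and> (\<forall>q\<in>R. (r, q, q) \<in> E)
     \<and> (\<forall>p\<in>R. \<forall>q\<in>R. (p, q) \<in> {(p, q). (r, p, q) \<in> E}\<^sup>*) \<and> (\<forall>p q. (r, p, q) \<in> E \<and> q \<in> R \<longrightarrow> p \<in> R)"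

text \<open>The choice depends on \<open>R\<close> alone, so processes detecting the same root pick
  the same member without communicating.\<close>

definition leader :: "'p set \<Rightarrow> 'p" where
  "leader R = (SOME q. q \<in> R)"

definition view_start :: "(nat \<times> 'p \<times> 'p) set \<Rightarrow> nat \<Rightarrow> 'p set \<Rightarrow> nat" where
  "view_start E r R = (LEAST s. 1 \<le> s \<and> (\<forall>i\<in>{s..r}. view_root E i R))"

definition view_val :: "(nat \<times> 'p \<times> 'p) set \<Rightarrow> (nat \<times> 'p \<times> 'v) set \<Rightarrow> nat \<Rightarrow> 'v" where
  "view_val E X r = (let R = THE R. view_root E r R
     in THE v. (view_start E r R - 1, leader R, v) \<in> X)"

text \<open>A process that has detected no root falls back on its own input, recorded as its
  estimate at time 0.\<close>

definition view_estimate ::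
    "'p \<Rightarrow> (nat \<times> 'p \<times> 'p) set \<Rightarrow> (nat \<times> 'p \<times> 'v) set \<Rightarrow> 'v" where
  "view_estimate p E X = (let S = {r. \<exists>R. view_root E r R}
     in if S = {} then THE v. (0, p, v) \<in> X else view_val E X (Max S))"

definition view_decidable ::
    "nat \<Rightarrow> (nat \<times> 'p \<times> 'p) set \<Rightarrow> (nat \<times> 'p \<times> 'v) set \<Rightarrow> 'v \<Rightarrow> bool" where
  "view_decidable N E X v \<longleftrightarrow>
     (\<exists>w. \<forall>r\<in>{w<..w + N}. (\<exists>R. view_root E r R) \<and> view_val E X r = v)"

section \<open>Encoding of knowledge as finite lists of facts, and the algorithm\<close>

fun edge_fact :: "nat \<times> 'p \<times> 'p \<Rightarrow> ('p, 'v) obj" where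
  "edge_fact (r, p, q) = Lst [Num r, Pid p, Pid q]"

fun val_fact :: "nat \<times> 'p \<times> 'v \<Rightarrow> ('p, 'v) obj" where
  "val_fact (t, p, v) = Lst [Num t, Pid p, Val v]"

fun facts :: "('p, 'v) obj \<Rightarrow> ('p, 'v) obj set" where
  "facts (Lst l) = set l"
| "facts _ = {}"

definition edges :: "('p, 'v) obj \<Rightarrow> (nat \<times> 'p \<times> 'p) set" where
  "edges s = edge_fact -` facts s"

definition vals :: "('p, 'v) obj \<Rightarrow> (nat \<times> 'p \<times> 'v) set" where
  "vals s = val_fact -` facts s"

text \<open>\<open>SOME\<close> fixes an arbitrary listing, as only the set of entries matters. Edge
  and estimate facts can share one list because their last entries have different
  constructors.\<close>

definition mk_state ::
    "(nat \<times> 'p \<times> 'p) set \<Rightarrow> (nat \<times> 'p \<times> 'v) set \<Rightarrow> ('p, 'v) obj" where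
  "mk_state E X = Lst (SOME l. set l = edge_fact ` E \<union> val_fact ` X)"

lemma facts_mk_state:
  assumes "finite E" "finite X"
  shows "facts (mk_state E X) = edge_fact ` E \<union> val_fact ` X"
proof -
  have "\<exists>l. set l = edge_fact ` E \<union> val_fact ` X"
    by (rule finite_list) (use assms in simp)
  from someI_ex[OF this] show ?thesis by (simp add: mk_state_def)
qed

lemma edges_mk_state: "finite E \<Longrightarrow> finite X \<Longrightarrow> edges (mk_state E X) = E"
  by (auto simp: edges_def facts_mk_state)

lemma vals_mk_state: "finite E \<Longrightarrow> finite X \<Longrightarrow> vals (mk_state E X) = X"
  by (auto simp: vals_def facts_mk_state)

text \<open>Because of the self-loop, the previous state of \<open>p\<close> arrives among the
  messages. It contains the latest estimate of \<open>p\<close>, so the largest time stamp received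
  is the previous time and serves as round counter.\<close>

definition step :: "'p \<Rightarrow> ('p \<Rightarrow> ('p, 'v) obj option) \<Rightarrow> ('p, 'v) obj" where
  "step p m =
     (let X = \<Union>(vals ` ran m);
          t = Suc (Max (fst ` X));
          E = \<Union>(edges ` ran m) \<union> {(t, q, p) |q. m q \<noteq> None}
      in mk_state E (insert (t, p, view_estimate p E X) X))"

text \<open>Decisions are not stored but recomputed from current knowledge; irrevocability will
  follow because knowledge only grows and the decidable value is unique.\<close>

definition alg :: "nat \<Rightarrow> ('p, 'v) algorithm" where
  "alg N = \<lparr>alg_init = (\<lambda>p v. mk_state {} {(0, p, v)}),
            alg_send = (\<lambda>p s. s),
            alg_step = (\<lambda>p s m. step p m),
            alg_dec = (\<lambda>p s. if \<exists>v. view_decidable N (edges s) (vals s) v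
                             then Some (SOME v. view_decidable N (edges s) (vals s) v) else None)\<rparr>"

lemma alg_simps [simp]:
  "alg_init (alg N) p v = mk_state {} {(0, p, v)}"
  "alg_send (alg N) p s = s"
  "alg_step (alg N) p s m = step p m"
  "alg_dec (alg N) p s = (if \<exists>v. view_decidable N (edges s) (vals s) v
     then Some (SOME v. view_decidable N (edges s) (vals s) v) else None)"
  by (simp_all add: alg_def)

section \<open>Detected roots\<close>

locale rooted_network =
  fixes Pi :: "'p set" and Gs :: "nat \<Rightarrow> ('p \<times> 'p) set" and x :: "'p \<Rightarrow> 'v"
  assumes finite_Pi: "finite Pi"
    and graph: "1 \<le> r \<Longrightarrow> is_graph Pi (Gs r)"
    and rooted: "1 \<le> r \<Longrightarrow> rooted Pi (Gs r)"
begin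

abbreviation RT :: "nat \<Rightarrow> 'p set" where
  "RT r \<equiv> Root Pi (Gs r)"

abbreviation cp :: "'p \<Rightarrow> nat \<Rightarrow> nat \<Rightarrow> 'p set" where
  "cp \<equiv> CP Gs"

lemma root_component_RT: "1 \<le> r \<Longrightarrow> root_component Pi (Gs r) (RT r)"
  by (simp add: root_component_Root rooted)

lemma RT_nonempty: "1 \<le> r \<Longrightarrow> RT r \<noteq> {}" and RT_subset: "1 \<le> r \<Longrightarrow> RT r \<subseteq> Pi"
  using root_component_RT by (auto simp: root_component_def)

lemma leader_in_RT: "1 \<le> r \<Longrightarrow> leader (RT r) \<in> RT r"
  using RT_nonempty unfolding leader_def by (simp add: some_in_eq)

lemma edge_in_Pi: "1 \<le> r \<Longrightarrow> (p, q) \<in> Gs r \<Longrightarrow> p \<in> Pi \<and> q \<in> Pi"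
  using graph by (auto simp: is_graph_def)

lemma self_loop: "1 \<le> r \<Longrightarrow> p \<in> Pi \<Longrightarrow> (p, p) \<in> Gs r"
  using graph by (auto simp: is_graph_def)

lemma cp_subset: "a \<le> b \<Longrightarrow> p \<in> Pi \<Longrightarrow> cp p a b \<subseteq> Pi"
proof (induction b arbitrary: p rule: dec_induct)
  case (step n)
  have "q \<in> Pi" if "(q, p) \<in> Gs (Suc n)" for q
    using edge_in_Pi[of "Suc n" q p] that by simp
  with step show ?case by (auto simp: CP_Suc)
qed simp

lemma cp_mono_time:
  assumes "a \<le> b" "b \<le> c" "p \<in> Pi" shows "cp p a b \<subseteq> cp p a c"
  using assms(2)
proof (induction c rule: dec_induct)
  case (step n)
  then show ?case using assms self_loop[of "Suc n" p] by (auto simp: CP_Suc)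
qed simp

lemma cp_antimono_round:
  assumes "a \<le> b" "b \<le> c" "p \<in> Pi" shows "cp p b c \<subseteq> cp p a c"
  using assms(1)
proof (induction a rule: inc_induct)
  case (step n)
  then have "cp p (Suc n) c \<subseteq> cp p n c"
    using assms self_loop[of "Suc n"] cp_subset[of "Suc n" c p]
    by (subst (2) CP_first_round) auto
  with step show ?case by blast
qed simp

lemma self_in_cp: "a \<le> b \<Longrightarrow> p \<in> Pi \<Longrightarrow> p \<in> cp p a b"
  using cp_mono_time[of a a b p] by simp

section \<open>Detection of roots and the bound on undetected rounds\<close>

definition det :: "'p \<Rightarrow> nat \<Rightarrow> nat set" where
  "det p t = {r \<in> {1..t}. RT r \<subseteq> cp p r t}"

lemma finite_det: "finite (det p t)"
  by (simp add: det_def)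

lemma det_mono: "t \<le> t' \<Longrightarrow> p \<in> Pi \<Longrightarrow> det p t \<subseteq> det p t'"
  using cp_mono_time by (fastforce simp: det_def)

text \<open>A causal past that does not grow when going back through round \<open>r\<close> is closed under
  in-neighbours in that round, and hence contains its root.\<close>
lemma undetected_grows:
  assumes "r \<in> {1..t}" "r \<notin> det p t" "p \<in> Pi"
  shows "card (cp p r t) < card (cp p (r - 1) t)"
proof -
  have r: "1 \<le> r" "r \<le> t" and first: "cp p (r - 1) t = {q. \<exists>q'\<in>cp p r t. (q, q') \<in> Gs r}"
    using assms(1) CP_first_round[of "r - 1" t Gs p] by auto
  have fin: "finite (cp p a t)" if "a \<le> t" for a
    using cp_subset[OF that assms(3)] finite_Pi finite_subset by blast
  have sub: "cp p r t \<subseteq> cp p (r - 1) t" using r cp_antimono_round assms(3) by simp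
  have "cp p r t \<noteq> cp p (r - 1) t"
  proof
    assume "cp p r t = cp p (r - 1) t"
    then have "p' \<in> cp p r t" if "(p', q) \<in> Gs r" "q \<in> cp p r t" for p' q
      using that first by blast
    then have "\<exists>R\<subseteq>cp p r t. root_component Pi (Gs r) R"
      using self_in_cp[OF r(2) assms(3)] cp_subset[OF r(2) assms(3)]
      by (intro closed_contains_root_component fin r graph) auto
    then obtain R where "R \<subseteq> cp p r t" "root_component Pi (Gs r) R" by metis
    then have "RT r \<subseteq> cp p r t"
      using Root_unique[OF rooted[OF r(1)]] by metis
    then show False using assms r by (simp add: det_def)
  qed
  then show ?thesis using sub fin r by (simp add: psubset_card_mono psubset_eq)
qed

text \<open>Going back from time \<open>t\<close>, the causal past starts as \<open>{p}\<close>,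
  gains a member at each undetected round and stays inside \<open>Pi\<close>. The initial member
  makes the bound strict.\<close>

lemma card_undetected:
  assumes "a \<le> t" "p \<in> Pi"
  shows "card ({a<..t} - det p t) < card Pi"
proof -
  have "card ({a<..t} - det p t) < card (cp p a t)"
    using assms(1)
  proof (induction a rule: inc_induct)
    case (step n)
    have *: "{n<..t} = insert (Suc n) {Suc n<..t}" using step by auto
    show ?case
    proof (cases "Suc n \<in> det p t")
      case True
      then have "card ({n<..t} - det p t) = card ({Suc n<..t} - det p t)"
        by (simp add: *)
      also have "\<dots> < card (cp p (Suc n) t)" by (fact step)
      also have "\<dots> \<le> card (cp p n t)"
        using cp_antimono_round[of n "Suc n" t p] cp_subset[of n t p] finite_Pi step assms
        by (intro card_mono) (auto intro: finite_subset)
      finally show ?thesis .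
    next
      case False
      then have "card ({n<..t} - det p t) = Suc (card ({Suc n<..t} - det p t))"
        by (simp add: * insert_Diff_if)
      moreover have "card (cp p (Suc n) t) < card (cp p n t)"
        using undetected_grows[of "Suc n" t p] False step assms by simp
      ultimately show ?thesis using step by simp
    qed
  qed simp
  also have "\<dots> \<le> card Pi" using cp_subset[OF assms] finite_Pi card_mono by blast
  finally show ?thesis .
qed

lemma detects_recent:
  assumes "card Pi \<le> N" "p \<in> Pi"
  shows "\<exists>r>w. r \<in> det p (w + N)"
proof (rule ccontr)
  assume "\<not> ?thesis"
  then have "{w<..w + N} - det p (w + N) = {w<..w + N}" by auto
  then show False using card_undetected[of w "w + N" p] assms by simp
qed

text \<open>The \<open>N * N\<close> rounds after \<open>a\<close> split into \<open>N\<close>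
  windows of length \<open>N\<close>. An undetected round in each would give \<open>N\<close>
  distinct undetected rounds, contradicting \<open>card_undetected\<close>.\<close>

lemma detects_window:
  assumes "card Pi \<le> N" "p \<in> Pi"
  shows "\<exists>w\<ge>a. {w<..w + N} \<subseteq> det p (a + N * N)"
proof (rule ccontr)
  let ?t = "a + N * N"
  assume "\<not> ?thesis"
  then have "\<exists>r. r \<in> {a + k * N<..a + k * N + N} - det p ?t" for k
    by (metis Diff_eq_empty_iff ex_in_conv le_add1)
  then obtain f where f: "\<And>k. f k \<in> {a + k * N<..a + k * N + N} - det p ?t" by metis
  have less: "f i < f j" if "i < j" for i j
  proof -
    have "i * N + N \<le> j * N" using that by (metis Suc_leI mult_Suc mult_le_mono1 add.commute)
    then show ?thesis using f[of i] f[of j] by simp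
  qed
  then have "inj_on f {..<N}" by (auto intro!: inj_onI) (metis linorder_neqE_nat less_irrefl)
  moreover have "f ` {..<N} \<subseteq> {a<..?t} - det p ?t"
  proof (rule image_subsetI)
    fix k assume "k \<in> {..<N}"
    then have "k * N + N \<le> N * N"
      by (metis Suc_leI lessThan_iff mult_Suc mult_le_mono1 add.commute)
    then show "f k \<in> {a<..?t} - det p ?t" using f[of k] by auto
  qed
  ultimately have "N \<le> card ({a<..?t} - det p ?t)"
    using card_inj_on_le[of f "{..<N}" "{a<..?t} - det p ?t"] by simp
  then show False using card_undetected[of a ?t p] assms by simp
qed

section \<open>Estimates\<close>

definition start :: "nat \<Rightarrow> nat" where
  "start r = (LEAST s. 1 \<le> s \<and> (\<forall>i\<in>{s..r}. RT i = RT r))"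

lemma
  assumes "1 \<le> r"
  shows start_le: "start r \<le> r" and start_ge: "1 \<le> start r"
    and RT_start: "i \<in> {start r..r} \<Longrightarrow> RT i = RT r"
proof -
  let ?P = "\<lambda>s. 1 \<le> s \<and> (\<forall>i\<in>{s..r}. RT i = RT r)"
  have P: "?P r" using assms by simp
  show "start r \<le> r" unfolding start_def using P by (rule Least_le)
  have "?P (start r)" unfolding start_def using P by (rule LeastI)
  then show "1 \<le> start r" "i \<in> {start r..r} \<Longrightarrow> RT i = RT r" by blast+
qed

lemma start_min: "1 \<le> s \<Longrightarrow> (\<And>i. i \<in> {s..r} \<Longrightarrow> RT i = RT r) \<Longrightarrow> start r \<le> s"
  unfolding start_def by (intro Least_le) blast

text \<open>Since \<open>r\<close> lies in the block ending in \<open>r'\<close>, the start of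
  either round is a candidate for the least start of the other.\<close>

lemma start_eq:
  assumes "1 \<le> r" "start r' \<le> r" "r \<le> r'"
  shows "RT r = RT r'" "start r = start r'"
proof -
  show eq: "RT r = RT r'"
  proof (rule RT_start)
    show "1 \<le> r'" "r \<in> {start r'..r'}" using assms by auto
  qed
  show "start r = start r'"
  proof (rule antisym)
    show "start r \<le> start r'"
    proof (rule start_min)
      show "1 \<le> start r'" using start_ge assms by simp
      show "RT i = RT r" if "i \<in> {start r'..r}" for i
        using RT_start[of r' i] that assms eq by simp
    qed
    show "start r' \<le> start r"
    proof (rule start_min)
      show "1 \<le> start r" using start_ge assms(1) .
      show "RT i = RT r'" if "i \<in> {start r..r'}" for i
      proof (cases "i \<le> r")
        case True
        then have "RT i = RT r" using RT_start[of r i] that assms(1) by simp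
        with eq show ?thesis by simp
      next
        case False
        then show ?thesis using RT_start[of r' i] that assms by simp
      qed
    qed
  qed
qed

text \<open>Estimates as a function of graphs and inputs alone; \<open>run_alg\<close> matches them
  with the computed ones. The recursion ends because a detected block starts by time
  \<open>t\<close> at the latest and its leader is consulted strictly before that round.\<close>

function est :: "'p \<Rightarrow> nat \<Rightarrow> 'v" where
  "est p t = (if det p t = {} then x p
     else est (leader (RT (Max (det p t)))) (start (Max (det p t)) - 1))"
  by auto
termination
proof (relation "measure snd")
  fix p t
  assume "det p t \<noteq> {}"
  then have "Max (det p t) \<in> det p t" using finite_det Max_in by blast
  then have "1 \<le> Max (det p t)" "Max (det p t) \<le> t" using det_def by auto
  then show "((leader (RT (Max (det p t))), start (Max (det p t)) - 1), p, t) \<in> measure snd"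
    using start_le[of "Max (det p t)"] by simp
qed simp

declare est.simps [simp del]

lemma est_0: "est p 0 = x p"
  by (subst est.simps) (simp add: det_def)

definition rval :: "nat \<Rightarrow> 'v" where
  "rval r = est (leader (RT r)) (start r - 1)"

lemma est_cases:
  assumes "p \<in> Pi"
  obtains "det p t = {}" "est p t = x p"
  | r where "r \<in> det p t" "\<And>i. i \<in> det p t \<Longrightarrow> i \<le> r" "est p t = rval r"
proof (cases "det p t = {}")
  case True
  then show ?thesis using that(1) by (simp add: est.simps[of p t])
next
  case False
  then show ?thesis using that(2)[of "Max (det p t)"] finite_det[of p t]
    by (simp add: est.simps[of p t] rval_def)
qed

lemma leader_in_Pi: "1 \<le> r \<Longrightarrow> leader (RT r) \<in> Pi"
  using leader_in_RT RT_subset by blast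

lemma est_valid: "p \<in> Pi \<Longrightarrow> \<exists>q\<in>Pi. est p t = x q"
proof (induction t arbitrary: p rule: less_induct)
  case (less t)
  show ?case
  proof (cases rule: est_cases[OF less(2), of t])
    case 1
    then show ?thesis using less(2) by blast
  next
    case (2 r)
    then have r: "1 \<le> r" "r \<le> t" by (auto simp: det_def)
    then have "start r - 1 < t" using start_le[of r] by simp
    then show ?thesis using less(1) leader_in_Pi r 2(3) by (simp add: rval_def)
  qed
qed

lemma rval_valid: "1 \<le> r \<Longrightarrow> \<exists>q\<in>Pi. rval r = x q"
  unfolding rval_def using est_valid leader_in_Pi by blast

text \<open>A block of rounds whose root changes after round \<open>w + L\<close> takes its value from an estimate at
  time \<open>w + L\<close> or later, which is itself the value of a round after \<open>w\<close>.\<close>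
lemma rval_forever:
  assumes "1 \<le> L" and const: "\<And>r. r \<in> {w<..w + L} \<Longrightarrow> rval r = v"
    and det: "\<And>q. q \<in> Pi \<Longrightarrow> \<exists>r>w. r \<in> det q (w + L)"
  shows "w < r \<Longrightarrow> rval r = v"
proof (induction r rule: less_induct)
  case (less r)
  consider "r \<le> w + L" | "w + L < r" "start r \<le> w + L" | "w + L < start r" by linarith
  then show ?case
  proof cases
    case 1
    then show ?thesis using const less(2) by simp
  next
    case 2
    \<comment> \<open>The block of \<open>r\<close> reaches back into the window, so it shares its
      start and leader with the last window round.\<close>
    then have "rval r = rval (w + L)"
      using start_eq[of "w + L" r] assms(1) by (simp add: rval_def)
    then show ?thesis using const assms(1) by simp
  next
    case 3
    let ?q = "leader (RT r)" and ?t = "start r - 1"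
    have q: "?q \<in> Pi" using leader_in_Pi less(2) by simp
    obtain r' where r': "w < r'" "r' \<in> det ?q (w + L)" using det q by blast
    have "w + L \<le> ?t" using 3 by simp
    then have r'_det: "r' \<in> det ?q ?t" using det_mono[of "w + L" ?t ?q] q r'(2) by blast
    show ?thesis
    proof (cases rule: est_cases[OF q, of ?t])
      case 1
      then show ?thesis using r'_det by simp
    next
      case (2 r'')
      \<comment> \<open>The leader uses its latest detected round \<open>r''\<close>, which is no
        earlier than \<open>r'\<close> and precedes the block of \<open>r\<close>; hence the
        induction hypothesis covers it.\<close>
      then have "r' \<le> r''" "r'' \<le> ?t" using r'_det by (auto simp: det_def)
      then have "w < r''" "r'' < r" using r' 3 start_le[of r] less(2) by auto
      then show ?thesis using less(1) 2(3) by (simp add: rval_def)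
    qed
  qed
qed

section \<open>Local views\<close>

text \<open>A receiver \<open>q\<close> learns all its in-edges of round \<open>r\<close> at the end
  of that round, so they reach \<open>p\<close> together, exactly when \<open>q\<close> is in
  \<open>cp p r t\<close>.\<close>

definition known_edges :: "'p \<Rightarrow> nat \<Rightarrow> (nat \<times> 'p \<times> 'p) set" where
  "known_edges p t = {(r, q', q). r \<in> {1..t} \<and> q \<in> cp p r t \<and> (q', q) \<in> Gs r}"

text \<open>The bound \<open>u\<close> on time stamps is separate from \<open>t\<close>: when a
  process computes its estimate for time \<open>Suc t\<close>, it has heard estimates only up to
  time \<open>t\<close>.\<close>

definition known_vals :: "'p \<Rightarrow> nat \<Rightarrow> nat \<Rightarrow> (nat \<times> 'p \<times> 'v) set" where
  "known_vals p t u = {(i, q, est q i) |i q. i \<le> u \<and> q \<in> cp p i t}"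

lemma finite_known_edges: "p \<in> Pi \<Longrightarrow> finite (known_edges p t)"
proof (rule finite_subset)
  show "known_edges p t \<subseteq> {1..t} \<times> Pi \<times> Pi"
    using edge_in_Pi by (auto simp: known_edges_def)
qed (simp add: finite_Pi)

lemma finite_known_vals:
  assumes "p \<in> Pi" "u \<le> t" shows "finite (known_vals p t u)"
proof (rule finite_subset)
  show "known_vals p t u \<subseteq> (\<lambda>(i, q). (i, q, est q i)) ` ({..u} \<times> Pi)"
  proof
    fix y assume "y \<in> known_vals p t u"
    then obtain i q where "y = (i, q, est q i)" "i \<le> u" "q \<in> cp p i t"
      by (auto simp: known_vals_def)
    moreover have "q \<in> Pi" using calculation assms cp_subset[of i t p] by auto
    ultimately show "y \<in> (\<lambda>(i, q). (i, q, est q i)) ` ({..u} \<times> Pi)" by force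
  qed
qed (simp add: finite_Pi)

text \<open>Knowing all in-edges of the members certifies a root: closure is visible, and paths
  between members stay among them. Conversely, a certified set is a root component of the true
  graph, hence its unique one.\<close>

lemma view_root_known:
  assumes p: "p \<in> Pi"
  shows "view_root (known_edges p t) r R \<longleftrightarrow> r \<in> det p t \<and> R = RT r"
proof
  let ?G = "{(q', q). (r, q', q) \<in> known_edges p t}"
  assume *: "view_root (known_edges p t) r R"
  then have ne: "R \<noteq> {}" and known: "\<And>q. q \<in> R \<Longrightarrow> (r, q, q) \<in> known_edges p t"
    and scc: "\<And>a b. a \<in> R \<Longrightarrow> b \<in> R \<Longrightarrow> (a, b) \<in> ?G\<^sup>*"
    and closed: "\<And>a b. (r, a, b) \<in> known_edges p t \<Longrightarrow> b \<in> R \<Longrightarrow> a \<in> R"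
    unfolding view_root_def by blast+
  have r: "r \<in> {1..t}" and R: "R \<subseteq> cp p r t"
    using ne known unfolding known_edges_def by blast+
  have "?G\<^sup>* \<subseteq> (Gs r)\<^sup>*" by (rule rtrancl_mono) (auto simp: known_edges_def)
  then have "(a, b) \<in> (Gs r)\<^sup>*" if "a \<in> R" "b \<in> R" for a b
    using that scc by blast
  moreover have "R \<subseteq> Pi" using R cp_subset[of r t p] r p by auto
  moreover have "a \<in> R" if "(a, b) \<in> Gs r" "b \<in> R" for a b
    using that r R by (intro closed[OF _ that(2)]) (auto simp: known_edges_def)
  ultimately have "root_component Pi (Gs r) R"
  proof (subst root_component_iff)
    show "is_graph Pi (Gs r)" using r graph by simp
  qed (use ne in blast)
  moreover have "rooted Pi (Gs r)" using r rooted by simp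
  ultimately have "R = RT r" by (rule Root_unique[rotated])
  with r R show "r \<in> det p t \<and> R = RT r" by (simp add: det_def)
next
  let ?G = "{(q', q). (r, q', q) \<in> known_edges p t}"
  assume *: "r \<in> det p t \<and> R = RT r"
  then have r: "r \<in> {1..t}" and R: "R \<subseteq> cp p r t" by (auto simp: det_def)
  have "root_component Pi (Gs r) R" using root_component_RT * r by simp
  then have ne: "R \<noteq> {}" and sub: "R \<subseteq> Pi"
    and scc: "\<And>a b. a \<in> R \<Longrightarrow> b \<in> R \<Longrightarrow> (a, b) \<in> (Gs r)\<^sup>*"
    and closed: "\<And>a b. (a, b) \<in> Gs r \<Longrightarrow> b \<in> R \<Longrightarrow> a \<in> R"
    unfolding root_component_def by blast+
  have "Gs r \<inter> UNIV \<times> R \<subseteq> ?G" using r R by (auto simp: known_edges_def)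
  then have mono: "(Gs r \<inter> UNIV \<times> R)\<^sup>* \<subseteq> ?G\<^sup>*" by (rule rtrancl_mono)
  show "view_root (known_edges p t) r R"
    unfolding view_root_def
  proof (intro conjI ballI allI impI)
    show "R \<noteq> {}" by (fact ne)
    show "(r, q, q) \<in> known_edges p t" if "q \<in> R" for q
      using that r R self_loop[of r q] sub by (auto simp: known_edges_def)
    show "(a, b) \<in> ?G\<^sup>*" if "a \<in> R" "b \<in> R" for a b
    proof (rule subsetD[OF mono])
      show "(a, b) \<in> (Gs r \<inter> UNIV \<times> R)\<^sup>*"
        using rtrancl_closed_restrict[OF scc[OF that] that(2) closed] by (rule conjunct2)
    qed
    show "a \<in> R" if "(r, a, b) \<in> known_edges p t \<and> b \<in> R" for a b
      using that closed[of a b] by (simp add: known_edges_def)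
  qed
qed

text \<open>Causal pasts grow backwards, so detecting \<open>r\<close> entails detecting every
  earlier round of its block and hearing the leader from before the start. That estimate is older
  than \<open>r\<close>, so estimates up to \<open>u\<close> suffice even for round
  \<open>Suc u\<close>.\<close>

lemma view_val_known:
  assumes p: "p \<in> Pi" and r: "r \<in> det p t" and u: "r \<le> Suc u" "u \<le> t"
  shows "view_val (known_edges p t) (known_vals p t u) r = rval r"
proof -
  have r': "1 \<le> r" "r \<le> t" and sub: "RT r \<subseteq> cp p r t" using r by (auto simp: det_def)
  have eq: "view_root (known_edges p t) i (RT r) \<longleftrightarrow> RT i = RT r" if i: "1 \<le> i" "i \<le> r" for i
  proof -
    have "RT r \<subseteq> cp p i t" using sub cp_antimono_round[OF i(2) r'(2) p] by blast
    then have "RT i = RT r \<Longrightarrow> i \<in> det p t" using i r'(2) by (simp add: det_def)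
    then show ?thesis unfolding view_root_known[OF p] by metis
  qed
  have "1 \<le> s \<and> (\<forall>i\<in>{s..r}. view_root (known_edges p t) i (RT r))
      \<longleftrightarrow> 1 \<le> s \<and> (\<forall>i\<in>{s..r}. RT i = RT r)" for s
    using eq by (meson atLeastAtMost_iff order_trans)
  then have "view_start (known_edges p t) r (RT r) = start r"
    by (simp add: view_start_def start_def)
  moreover have "leader (RT r) \<in> cp p (start r - 1) t"
  proof -
    have "start r - 1 \<le> r" using start_le[OF r'(1)] by simp
    then show ?thesis
      using leader_in_RT[OF r'(1)] sub cp_antimono_round[of "start r - 1" r t p] p r'(2) by blast
  qed
  moreover have "(THE R. view_root (known_edges p t) r R) = RT r"
    using r by (simp add: view_root_known[OF p])
  moreover have "start r - 1 \<le> u" using u start_le[OF r'(1)] by simp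
  ultimately show ?thesis by (simp add: view_val_def known_vals_def rval_def)
qed

lemma view_estimate_known:
  assumes p: "p \<in> Pi"
  shows "view_estimate p (known_edges p (Suc t)) (known_vals p (Suc t) t) = est p (Suc t)"
proof -
  have S: "{r. \<exists>R. view_root (known_edges p (Suc t)) r R} = det p (Suc t)"
    by (auto simp: view_root_known p)
  show ?thesis
  proof (cases "det p (Suc t) = {}")
    case True
    then show ?thesis
      using self_in_cp[of 0 "Suc t" p] p
      by (simp add: view_estimate_def Let_def S known_vals_def est.simps[of p "Suc t"] est_0)
  next
    case False
    then have "Max (det p (Suc t)) \<in> det p (Suc t)" using finite_det Max_in by blast
    moreover from this have "Max (det p (Suc t)) \<le> Suc t" unfolding det_def by simp
    ultimately have "view_val (known_edges p (Suc t)) (known_vals p (Suc t) t) (Max (det p (Suc t)))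
        = rval (Max (det p (Suc t)))"
      using p by (intro view_val_known) auto
    with False show ?thesis
      by (simp add: view_estimate_def Let_def S rval_def est.simps[of p "Suc t"])
  qed
qed

text \<open>The link between execution and analysis: a state holds precisely the edges and estimates
  in the causal past.\<close>

lemma run_alg:
  "p \<in> Pi \<Longrightarrow> run (alg N) Pi Gs x t p = mk_state (known_edges p t) (known_vals p t t)"
proof (induction t arbitrary: p)
  case 0
  have "known_edges p 0 = {}" "known_vals p 0 0 = {(0, p, x p)}"
    by (auto simp: known_edges_def known_vals_def est_0)
  then show ?case by simp
next
  case (Suc t)
  define m where "m q = (if q \<in> Pi \<and> (q, p) \<in> Gs (Suc t)
    then Some (run (alg N) Pi Gs x t q) else None)" for q
  let ?S = "{q. (q, p) \<in> Gs (Suc t)}"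
  have S: "q \<in> Pi" if "q \<in> ?S" for q using that edge_in_Pi[of "Suc t" q p] by simp
  have "ran m = (\<lambda>q. mk_state (known_edges q t) (known_vals q t t)) ` ?S"
  proof -
    have "m q = (if q \<in> ?S then Some (mk_state (known_edges q t) (known_vals q t t)) else None)" for q
      using S Suc(1) by (auto simp: m_def)
    then show ?thesis by (auto simp: ran_def)
  qed
  then have E: "\<Union>(edges ` ran m) = (\<Union>q\<in>?S. known_edges q t)"
    and X: "\<Union>(vals ` ran m) = (\<Union>q\<in>?S. known_vals q t t)"
    using S by (auto simp: edges_mk_state vals_mk_state finite_known_edges finite_known_vals)
  have X': "\<Union>(vals ` ran m) = known_vals p (Suc t) t"
    unfolding X by (fastforce simp: known_vals_def CP_Suc)
  \<comment> \<open>Every process is in its own causal past, so each time stamp up to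
    \<open>t\<close> occurs and the maximum taken in \<open>step\<close> is
    \<open>t\<close>.\<close>
  have "(i, p, est p i) \<in> known_vals p (Suc t) t" if "i \<le> t" for i
    using self_in_cp[of i "Suc t" p] Suc(2) that by (auto simp: known_vals_def)
  then have "fst ` known_vals p (Suc t) t = {..t}"
    by (force simp: known_vals_def image_iff)
  then have Max: "Max (fst ` known_vals p (Suc t) t) = t" by (simp add: Max_eq_iff)
  have E': "\<Union>(edges ` ran m) \<union> {(Suc t, q, p) |q. m q \<noteq> None} = known_edges p (Suc t)"
  proof -
    have "m q \<noteq> None \<longleftrightarrow> (q, p) \<in> Gs (Suc t)" for q using S by (auto simp: m_def)
    \<comment> \<open>The causal past from time \<open>Suc t\<close> to itself is
      \<open>{p}\<close>, so the edges of round \<open>Suc t\<close> that become known are those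
      into \<open>p\<close>.\<close>
    moreover have "(r, q', q) \<in> known_edges p (Suc t) \<longleftrightarrow>
        (\<exists>s\<in>?S. (r, q', q) \<in> known_edges s t) \<or> r = Suc t \<and> q = p \<and> (q', p) \<in> Gs (Suc t)" for r q q'
      by (cases "r \<le> t") (auto simp: known_edges_def CP_Suc le_Suc_eq)
    ultimately show ?thesis unfolding E by auto
  qed
  have X'': "insert (Suc t, p, est p (Suc t)) (known_vals p (Suc t) t) = known_vals p (Suc t) (Suc t)"
    by (auto simp: known_vals_def le_Suc_eq)
  have "run (alg N) Pi Gs x (Suc t) p = step p m"
    by (simp add: m_def[abs_def] cong: if_cong)
  also have "\<dots> = mk_state (known_edges p (Suc t)) (known_vals p (Suc t) (Suc t))"
    unfolding step_def X' Max Let_def E' view_estimate_known[OF Suc(2)] X'' ..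
  finally show ?case .
qed

section \<open>Safety of decisions and eventual stabilisation\<close>

definition decidable_val :: "nat \<Rightarrow> 'p \<Rightarrow> nat \<Rightarrow> 'v \<Rightarrow> bool" where
  "decidable_val N p t v \<longleftrightarrow> (\<exists>w. {w<..w + N} \<subseteq> det p t \<and> (\<forall>r\<in>{w<..w + N}. rval r = v))"

lemma decision_alg:
  assumes "p \<in> Pi"
  shows "decision (alg N) Pi Gs x t p =
    (if \<exists>v. decidable_val N p t v then Some (SOME v. decidable_val N p t v) else None)"
proof -
  have "(\<exists>R. view_root (known_edges p t) r R) \<and> view_val (known_edges p t) (known_vals p t t) r = v
      \<longleftrightarrow> r \<in> det p t \<and> rval r = v" for r v
  proof (cases "r \<in> det p t")
    case True
    then have "r \<le> Suc t" by (simp add: det_def)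
    then show ?thesis using True view_val_known[OF assms True, of t] by (simp add: view_root_known assms)
  qed (simp add: view_root_known assms)
  then have "view_decidable N (known_edges p t) (known_vals p t t) = decidable_val N p t"
    by (simp add: fun_eq_iff view_decidable_def decidable_val_def subset_eq ball_conj_distrib)
  moreover have "decision (alg N) Pi Gs x t p =
    (if \<exists>v. view_decidable N (known_edges p t) (known_vals p t t) v
     then Some (SOME v. view_decidable N (known_edges p t) (known_vals p t t) v) else None)"
    by (simp add: decision_def run_alg assms edges_mk_state vals_mk_state finite_known_edges
        finite_known_vals)
  ultimately show ?thesis by simp
qed

text \<open>The window length \<open>N\<close> guarantees that by its end every process has detected
  a round inside it, which is what \<open>rval_forever\<close> asks for.\<close>

lemma decidable_val_forever:
  assumes "Pi \<noteq> {}" "card Pi \<le> N" "decidable_val N p t v"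
  shows "\<exists>w. \<forall>r>w. rval r = v"
proof -
  obtain w where "\<And>r. r \<in> {w<..w + N} \<Longrightarrow> rval r = v"
    using assms(3) unfolding decidable_val_def by blast
  moreover have "1 \<le> N" using assms(1,2) finite_Pi by (metis One_nat_def Suc_leI card_gt_0_iff order_less_le_trans)
  ultimately have "rval r = v" if "w < r" for r
    using that by (intro rval_forever[of N w v r] detects_recent[OF assms(2)]) auto
  then show ?thesis by blast
qed

text \<open>Each decidable value is the value of all late rounds, so a round beyond both thresholds
  compares the two.\<close>

lemma decidable_val_unique:
  assumes "Pi \<noteq> {}" "card Pi \<le> N" "decidable_val N p t v" "decidable_val N q u v'"
  shows "v = v'"
proof -
  obtain w where w: "\<forall>r>w. rval r = v"
    using decidable_val_forever[OF assms(1-3)] by (rule exE)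
  obtain w' where w': "\<forall>r>w'. rval r = v'"
    using decidable_val_forever[OF assms(1,2,4)] by (rule exE)
  have "rval (Suc (max w w')) = v" using w by (meson less_Suc_eq_le max.cobounded1)
  moreover have "rval (Suc (max w w')) = v'" using w' by (meson less_Suc_eq_le max.cobounded2)
  ultimately show ?thesis by simp
qed

lemma decidable_val_mono:
  "p \<in> Pi \<Longrightarrow> t \<le> t' \<Longrightarrow> decidable_val N p t v \<Longrightarrow> decidable_val N p t' v"
  unfolding decidable_val_def by (meson det_mono order_trans)

lemma decidable_val_valid:
  assumes "Pi \<noteq> {}" "card Pi \<le> N" "decidable_val N p t v"
  shows "\<exists>q\<in>Pi. v = x q"
proof -
  obtain w where "\<forall>r>w. rval r = v" using decidable_val_forever[OF assms] by (rule exE)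
  then have "rval (Suc w) = v" by simp
  then show ?thesis using rval_valid[of "Suc w"] by simp
qed

text \<open>The \<open>D + 1\<close> rounds play the part of the window in
  \<open>rval_forever\<close>: they share one value, and by their end every process has detected the
  first of them.\<close>

lemma stable_rval:
  assumes D: "1 \<le> D" and stab: "Gs \<in> EV_STABILITY Pi (D + 1)" and diam: "Gs \<in> DIAM Pi D"
  shows "\<exists>w v. \<forall>r>w. rval r = v"
proof -
  obtain R a l where a: "1 \<le> a" "D + 1 \<le> l" and stable: "R_rooted_seq Pi Gs R a (a + l - 1)"
    using stab unfolding EV_STABILITY_def mem_Collect_eq by metis
  have RT: "RT r = R" if "a \<le> r" "r \<le> a + D" for r
  proof -
    have "r \<in> {a..a + l - 1}" using that a(2) by simp
    then show ?thesis using stable unfolding R_rooted_seq_def by metis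
  qed
  \<comment> \<open>DIAM is applied to the last \<open>D\<close> rounds, so that the causal past
    reaches back to time \<open>a\<close>, the end of round \<open>a\<close>, as detection of that
    round demands.\<close>
  then have next_seq: "R_rooted_seq Pi Gs R (a + 1) (a + 1 + D - 1)"
    unfolding R_rooted_seq_def using rooted by simp
  have heard: "R \<subseteq> cp p a (a + D)" if "p \<in> Pi" for p
  proof -
    have "\<forall>p\<in>Pi. R \<subseteq> cp p (a + 1 - 1) (a + 1 + D - 1)"
      using diam next_seq unfolding DIAM_def mem_Collect_eq by (metis le_add2)
    then show ?thesis using that by simp
  qed
  have "rval r = rval (a + D)" if "r \<in> {a - 1<..a - 1 + (D + 1)}" for r
  proof -
    have r: "a \<le> r" "r \<le> a + D" using that a(1) by auto
    \<comment> \<open>The maximal block may begin before \<open>a\<close>; it only matters that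
      rounds \<open>a\<close> to \<open>a + D\<close> all lie in it.\<close>
    have "start (a + D) \<le> a"
    proof (rule start_min)
      show "RT i = RT (a + D)" if "i \<in> {a..a + D}" for i
        using RT[of i] RT[of "a + D"] that by simp
    qed (fact a(1))
    then have "start (a + D) \<le> r" "1 \<le> r" using r a(1) by simp_all
    then have "RT r = RT (a + D) \<and> start r = start (a + D)"
      using r(2) by (intro conjI start_eq)
    then show ?thesis by (simp add: rval_def)
  qed
  moreover have "\<exists>r>a - 1. r \<in> det p (a - 1 + (D + 1))" if "p \<in> Pi" for p
    using heard[OF that] RT[of a] a(1) by (intro exI[of _ a]) (simp add: det_def)
  ultimately have "rval r = rval (a + D)" if "a - 1 < r" for r
    using that by (rule rval_forever[OF le_add2])
  then show ?thesis by blast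
qed

lemma eventually_decidable:
  assumes "card Pi \<le> N" "p \<in> Pi" "\<And>r. w < r \<Longrightarrow> rval r = v"
  shows "\<exists>t. decidable_val N p t v"
proof -
  obtain u where "w \<le> u" "{u<..u + N} \<subseteq> det p (w + N * N)"
    using detects_window[OF assms(1,2)] by blast
  moreover have "\<forall>r\<in>{u<..u + N}. rval r = v" using assms(3) \<open>w \<le> u\<close> by simp
  ultimately show ?thesis unfolding decidable_val_def by blast
qed

text \<open>Uniqueness of the decidable value makes the \<open>SOME\<close> in the decision rule
  return it, so the consensus properties reduce to facts about \<open>decidable_val\<close>.\<close>

lemma decision_iff:
  assumes "Pi \<noteq> {}" "card Pi \<le> N" "p \<in> Pi"
  shows "decision (alg N) Pi Gs x t p = Some v \<longleftrightarrow> decidable_val N p t v"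
proof -
  have some: "(SOME v. decidable_val N p t v) = v" if "decidable_val N p t v" for v
    using that by (rule some_equality) (rule decidable_val_unique[OF assms(1,2) _ that])
  show ?thesis
  proof (cases "\<exists>v. decidable_val N p t v")
    case True
    then obtain u where u: "decidable_val N p t u" by blast
    then have "v = u" if "decidable_val N p t v"
      using that decidable_val_unique[OF assms(1,2)] by blast
    with u show ?thesis by (auto simp: decision_alg[OF assms(3)] some[OF u])
  qed (simp add: decision_alg[OF assms(3)])
qed

end

theorem theorem3:
  fixes D N :: nat
  assumes "D \<ge> 1"
  shows "\<exists>A :: ('p, 'v) algorithm. \<forall>Pi :: 'p set.
           finite Pi \<and> Pi \<noteq> {} \<and> card Pi \<le> N \<longrightarrow>
           solves_consensus A Pi (EV_STABLE Pi D (D + 1))"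
proof (intro exI allI impI)
  fix Pi :: "'p set"
  assume Pi: "finite Pi \<and> Pi \<noteq> {} \<and> card Pi \<le> N"
  show "solves_consensus (alg N :: ('p, 'v) algorithm) Pi (EV_STABLE Pi D (D + 1))"
    unfolding solves_consensus_def
  proof (intro allI ballI)
    fix x :: "'p \<Rightarrow> 'v" and Gs
    assume Gs: "Gs \<in> EV_STABLE Pi D (D + 1)"
    interpret rooted_network Pi Gs x
      using Pi Gs by unfold_locales (auto simp: EV_STABLE_def GRAPH_SEQS_def ROOTED_def)
    have ne: "Pi \<noteq> {}" and N: "card Pi \<le> N" using Pi by auto
    note dec = decision_iff[OF ne N]
    have "Gs \<in> EV_STABILITY Pi (D + 1)" "Gs \<in> DIAM Pi D"
      using Gs unfolding EV_STABLE_def by blast+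
    then obtain w v where stable: "\<forall>r>w. rval r = v"
      using stable_rval[OF assms] by blast
    show "(\<forall>p\<in>Pi. \<exists>r v. decision (alg N) Pi Gs x r p = Some v) \<and>
      (\<forall>p\<in>Pi. \<forall>r r' v. r \<le> r' \<and> decision (alg N) Pi Gs x r p = Some v
                          \<longrightarrow> decision (alg N) Pi Gs x r' p = Some v) \<and>
      (\<forall>p\<in>Pi. \<forall>q\<in>Pi. \<forall>r r' v w. decision (alg N) Pi Gs x r p = Some v
        \<and> decision (alg N) Pi Gs x r' q = Some w \<longrightarrow> v = w) \<and>
      (\<forall>p\<in>Pi. \<forall>r v. decision (alg N) Pi Gs x r p = Some v \<longrightarrow> (\<exists>q\<in>Pi. v = x q))"
    proof (intro conjI ballI allI impI; (elim conjE)?)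
      fix p assume p: "p \<in> Pi"
      have "\<exists>t. decidable_val N p t v"
        using stable by (intro eventually_decidable[OF N p, of w]) simp
      then show "\<exists>r v. decision (alg N) Pi Gs x r p = Some v"
        unfolding dec[OF p] by (elim exE) (intro exI)
    next
      fix p r r' v
      assume "p \<in> Pi" "r \<le> r'" "decision (alg N) Pi Gs x r p = Some v"
      then show "decision (alg N) Pi Gs x r' p = Some v"
        by (simp add: dec decidable_val_mono)
    next
      fix p q r r' v w
      assume "p \<in> Pi" "q \<in> Pi"
        and "decision (alg N) Pi Gs x r p = Some v" "decision (alg N) Pi Gs x r' q = Some w"
      then have "decidable_val N p r v" "decidable_val N q r' w" by (simp_all add: dec)
      then show "v = w" by (rule decidable_val_unique[OF ne N])
    next
      fix p r v
      assume "p \<in> Pi" "decision (alg N) Pi Gs x r p = Some v"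
      then have "decidable_val N p r v" by (simp add: dec)
      then show "\<exists>q\<in>Pi. v = x q" by (rule decidable_val_valid[OF ne N])
    qed
  qed
qed

end
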